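(* Let $m$ be a positive integer. Every positive integer solution $n$ of \[\sigma_2(n)-n^2=L_{2m}\,n+(L_{2m}^2-3)\] with $n>(L_{2m}^2+L_{2m}-3)^3$ is of the form $n=L_{2k-1}L_{2k+2m-1}$ for some positive integer $k$, where both $L_{2k-1}$ and $L_{2k+2m-1}$ are primes.
   Context: $\sigma_2(n)=\sum_{d\mid n}d^2$. $L_n$ are the Lucas numbers: $L_0=2$, $L_1=1$, $L_n=L_{n-1}+L_{n-2}$. A Lucas prime is a Lucas number that is prime. *)

theory Defs
  imports "HOL-Computational_Algebra.Primes"
begin

fun lucas :: "nat \<Rightarrow> nat" where
  "lucas 0 = 2"
| "lucas (Suc 0) = 1"
| "lucas (Suc (Suc n)) = lucas (Suc n) + lucas n"

definition sigma2 :: "nat \<Rightarrow> nat" where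
  "sigma2 n = (\<Sum>d | d dvd n. d\<^sup>2)"

end

theory Submission
  imports Defs "HOL-Number_Theory.Fib"
begin

text \<open>
  Write $A = L_{2m}$ and $B = A^2 - 3$. If $p$ is the least prime factor of $n$, the divisor $n/p$
  alone gives $(n/p)^2 \le An + B \le (A + B)n$, and then $n > (A+B)^3$ forces $n < p^3$, so $n$ has at
  most two prime factors. Primes and squares of primes violate the equation, and for $n = pq$ it
  reads $p^2 - Apq + q^2 = A^2 - 4 = 5F_{2m}^2$. Completing the square, $2p - Aq = 5F_{2m}y$ with
  $q^2 - 5y^2 = -4$; hence $q = L_j$ and $y = \pm F_j$ for some odd $j$, and the addition formula
  gives $p = L_{j \pm 2m}$.
\<close>

subsection \<open>Lucas and Fibonacci numbers\<close>

text \<open>With phi = (1 + sqrt 5)/2 and phi^n = (L_n + F_n sqrt 5)/2, these are the two components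
  of phi^(a+b) = phi^a phi^b. All sides obey the Fibonacci recurrence in \<open>a\<close>, so the
  cases a = 0 and a = 1 suffice.\<close>

lemma lucas_fib_add:
  "2 * lucas (a + b) = lucas a * lucas b + 5 * fib a * fib b"
  "2 * fib (a + b) = fib a * lucas b + lucas a * fib b"
proof -
  have "2 * lucas (a + b) = lucas a * lucas b + 5 * fib a * fib b \<and>
        2 * fib (a + b) = fib a * lucas b + lucas a * fib b"
  proof (induction a rule: lucas.induct)
    case 1
    then show ?case by simp
  next
    case 2
    show ?case
      by (induction b rule: lucas.induct) (simp_all add: algebra_simps)
  next
    case (3 n)
    then show ?case by (simp add: algebra_simps)
  qed
  then show "2 * lucas (a + b) = lucas a * lucas b + 5 * fib a * fib b"
    "2 * fib (a + b) = fib a * lucas b + lucas a * fib b" by auto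
qed

text \<open>Four times the norm of phi^n; each further factor phi has norm -1 and flips the
  sign.\<close>

lemma lucas_fib_norm: "(int (lucas n))\<^sup>2 - 5 * (int (fib n))\<^sup>2 = 4 * (-1) ^ n"
proof (induction n)
  case 0
  then show ?case by simp
next
  case (Suc n)
  have "2 * lucas (Suc n) = lucas n + 5 * fib n" "2 * fib (Suc n) = fib n + lucas n"
    using lucas_fib_add[of n 1] by simp_all
  then have e: "2 * int (lucas (Suc n)) = int (lucas n) + 5 * int (fib n)"
    "2 * int (fib (Suc n)) = int (fib n) + int (lucas n)" by presburger+
  have "4 * ((int (lucas (Suc n)))\<^sup>2 - 5 * (int (fib (Suc n)))\<^sup>2)
      = (2 * int (lucas (Suc n)))\<^sup>2 - 5 * (2 * int (fib (Suc n)))\<^sup>2"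
    by (simp add: power2_eq_square)
  also have "\<dots> = - 4 * ((int (lucas n))\<^sup>2 - 5 * (int (fib n))\<^sup>2)"
    unfolding e by (simp add: power2_eq_square algebra_simps)
  finally show ?case using Suc by simp
qed

text \<open>The rational component of conj(phi^a) phi^(a+b) = (-1)^a phi^b. It serves index
  subtraction, with \<open>b\<close> as the difference.\<close>

lemma lucas_fib_diff:
  "int (lucas a) * int (lucas (a + b)) - 5 * int (fib a) * int (fib (a + b))
    = 2 * (-1) ^ a * int (lucas b)"
proof -
  have e: "2 * int (lucas (a + b)) = int (lucas a) * int (lucas b) + 5 * int (fib a) * int (fib b)"
    "2 * int (fib (a + b)) = int (fib a) * int (lucas b) + int (lucas a) * int (fib b)"
    using arg_cong[OF lucas_fib_add(1)[of a b], of int] arg_cong[OF lucas_fib_add(2)[of a b], of int]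
    by simp_all
  have "2 * (int (lucas a) * int (lucas (a + b)) - 5 * int (fib a) * int (fib (a + b)))
      = int (lucas a) * (2 * int (lucas (a + b))) - 5 * int (fib a) * (2 * int (fib (a + b)))"
    by simp
  also have "\<dots> = ((int (lucas a))\<^sup>2 - 5 * (int (fib a))\<^sup>2) * int (lucas b)"
    unfolding e by (simp add: power2_eq_square algebra_simps)
  finally show ?thesis unfolding lucas_fib_norm by simp
qed

lemma lucas_even_ge_3:
  assumes "m > 0"
  shows "lucas (2 * m) \<ge> 3"
  using assms
proof (induction m rule: nat_induct_non_zero)
  case 1
  then show ?case by (simp add: numeral_2_eq_2)
next
  case (Suc m)
  then show ?case by simp
qed

text \<open>Descent by the unit $(3 + \surd 5)/2$.\<close>

lemma pell_minus_4_lucas_fib: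
  fixes x y :: nat
  assumes "5 * y\<^sup>2 = x\<^sup>2 + 4"
  shows "\<exists>j. odd j \<and> x = lucas j \<and> y = fib j"
  using assms
proof (induction y arbitrary: x rule: less_induct)
  case (less y)
  have y0: "y > 0" using less.prems by (cases y) auto
  show ?case
  proof (cases "y = 1")
    case True
    then have "x\<^sup>2 = 1\<^sup>2" using less.prems by simp
    then have "x = 1" by (simp only: power2_eq_iff_nonneg)
    then show ?thesis using True by (intro exI[of _ 1]) simp
  next
    case False
    then have y2: "y \<ge> 2" using y0 by simp
    then have "2\<^sup>2 \<le> y\<^sup>2" by (rule power_mono) simp
    then have ysq: "y\<^sup>2 \<ge> 4" by simp
    \<comment> \<open>The bounds x < 3y and 5y \<le> 3x keep the subtractions below from truncating,
      and y < x makes the descent strict. The second fails at x = y = 1, the base case.\<close>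
    have "x\<^sup>2 < (3 * y)\<^sup>2" using less.prems y0 by (simp add: power_mult_distrib)
    then have x1: "x < 3 * y" by (rule power_less_imp_less_base) simp
    have "(5 * y)\<^sup>2 \<le> (3 * x)\<^sup>2" using less.prems ysq by (simp add: power_mult_distrib)
    then have x2: "5 * y \<le> 3 * x" by (rule power2_le_imp_le) simp
    have "y\<^sup>2 < x\<^sup>2" using less.prems ysq by linarith
    then have x3: "y < x" by (rule power_less_imp_less_base) simp
    have "even (5 * y\<^sup>2) = even (x\<^sup>2 + 4)" using less.prems by simp
    then have par: "even x = even y" by simp
    \<comment> \<open>u + v sqrt 5 = (x + y sqrt 5)(3 - sqrt 5)/2, that is, division by phi^2. Equal
      parity of x and y makes the halves exact.\<close>
    define u where "u = (3 * x - 5 * y) div 2"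
    define v where "v = (3 * y - x) div 2"
    have "even (3 * x - 5 * y)" "even (3 * y - x)" using par x1 x2 by simp_all
    then have "2 * u = 3 * x - 5 * y" "2 * v = 3 * y - x" by (simp_all add: u_def v_def)
    then have u: "2 * u + 5 * y = 3 * x" and v: "2 * v + x = 3 * y" using x1 x2 by linarith+
    have iu: "2 * int u = 3 * int x - 5 * int y" and iv: "2 * int v = 3 * int y - int x"
      using u v by linarith+
    have ieq: "5 * (int y)\<^sup>2 = (int x)\<^sup>2 + 4"
      using arg_cong[OF less.prems, of int] by simp
    have "5 * (2 * int v)\<^sup>2 = (2 * int u)\<^sup>2 + 16"
      unfolding iu iv using ieq by (simp add: power2_eq_square algebra_simps)
    then have "5 * (int v)\<^sup>2 = (int u)\<^sup>2 + 4" by (simp add: power_mult_distrib)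
    then have "int (5 * v\<^sup>2) = int (u\<^sup>2 + 4)" by simp
    then have "5 * v\<^sup>2 = u\<^sup>2 + 4" by (simp only: of_nat_eq_iff)
    moreover have "v < y" using v x3 by linarith
    ultimately obtain j where j: "odd j" "u = lucas j" "v = fib j" using less.IH by blast
    \<comment> \<open>Multiplying back by phi^2 raises the index by 2, so it stays odd.\<close>
    have "2 * lucas (Suc (Suc j)) = 3 * lucas j + 5 * fib j"
      "2 * fib (Suc (Suc j)) = lucas j + 3 * fib j"
      using lucas_fib_add[of j "Suc (Suc 0)"] by simp_all
    then have "x = lucas (Suc (Suc j))" "y = fib (Suc (Suc j))"
      using u v j(2,3) by linarith+
    then show ?thesis using j(1) by (intro exI[of _ "Suc (Suc j)"]) simp
  qed
qed

text \<open>As a quadratic in p, the equation has discriminant 5 F^2 (q^2 + 4) with F = F_{2m},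
  which must be a square. The choice of root, recorded in the sign of \<open>Y\<close>, decides
  which of p and q has the larger index.\<close>

lemma lucas_quadratic_solutions:
  fixes p q m :: nat
  assumes "m > 0" "p > 0"
    and eq: "(int p)\<^sup>2 + (int q)\<^sup>2 - int (lucas (2 * m)) * int p * int q
      = (int (lucas (2 * m)))\<^sup>2 - 4"
  shows "\<exists>j. odd j \<and> (q = lucas j \<and> p = lucas (j + 2 * m) \<or> p = lucas j \<and> q = lucas (j + 2 * m))"
proof -
  define A where "A = int (lucas (2 * m))"
  define F where "F = int (fib (2 * m))"
  have D: "A\<^sup>2 - 4 = 5 * F\<^sup>2"
    using lucas_fib_norm[of "2 * m"] by (simp add: A_def F_def)
  have F0: "F > 0" using assms(1) by (simp add: F_def fib_neq_0_nat)
  define X where "X = 2 * int p - A * int q"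
  have "X\<^sup>2 = 4 * ((int p)\<^sup>2 + (int q)\<^sup>2 - A * int p * int q) + (A\<^sup>2 - 4) * (int q)\<^sup>2"
    by (simp add: X_def power2_eq_square algebra_simps)
  also have "\<dots> = 5 * F\<^sup>2 * ((int q)\<^sup>2 + 4)"
    using eq[folded A_def] by (simp add: D algebra_simps)
  finally have X: "X\<^sup>2 = F\<^sup>2 * (5 * ((int q)\<^sup>2 + 4))" by simp
  then have "F\<^sup>2 dvd X\<^sup>2" by simp
  then have "F dvd X" by simp
  then obtain Z where Z: "X = F * Z" by (elim dvdE)
  have Z2: "Z\<^sup>2 = 5 * ((int q)\<^sup>2 + 4)"
    using X F0 by (simp add: Z power_mult_distrib)
  have "prime (5 :: int)" by simp
  moreover have "5 dvd Z\<^sup>2" unfolding Z2 by simp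
  ultimately have "5 dvd Z" by (rule prime_dvd_power)
  then obtain Y where Y: "Z = 5 * Y" by (elim dvdE)
  have "5 * Y\<^sup>2 = (int q)\<^sup>2 + 4" using Z2 by (simp add: Y power_mult_distrib)
  then have "int (5 * (nat \<bar>Y\<bar>)\<^sup>2) = int (q\<^sup>2 + 4)" by simp
  then have "5 * (nat \<bar>Y\<bar>)\<^sup>2 = q\<^sup>2 + 4" by (simp only: of_nat_eq_iff)
  then obtain j where j: "odd j" "q = lucas j" "nat \<bar>Y\<bar> = fib j"
    using pell_minus_4_lucas_fib by blast
  have p: "2 * int p = A * int (lucas j) + 5 * F * Y"
    using X_def by (simp add: Z Y j(2))
  show ?thesis
  proof (cases "Y \<ge> 0")
    case True
    then have "Y = int (fib j)" using j(3) by simp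
    then have "2 * int p = int (2 * lucas (j + 2 * m))"
      unfolding p lucas_fib_add by (simp add: A_def F_def)
    then have "p = lucas (j + 2 * m)" by simp
    then show ?thesis using j by blast
  next
    case False
    then have "Y = - int (fib j)" using j(3) by simp
    then have p': "2 * int p = int (lucas (2 * m)) * int (lucas j) - 5 * int (fib (2 * m)) * int (fib j)"
      unfolding p by (simp add: A_def F_def)
    show ?thesis
    proof (cases "2 * m \<le> j")
      case True
      \<comment> \<open>Here b is odd, since j is, and q = L_{b+2m}.\<close>
      then obtain b where b: "j = 2 * m + b" by (auto simp: le_iff_add)
      have "p = lucas b" using p' lucas_fib_diff[of "2 * m" b] by (simp add: b)
      then show ?thesis using j b by (intro exI[of _ b]) (auto simp: add.commute)
    next
      case False
      then obtain b where b: "2 * m = j + b" by (metis le_iff_add nat_le_linear)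
      \<comment> \<open>The sign (-1)^j is -1 because j is odd, so this root is negative.\<close>
      have "2 * int p = - 2 * int (lucas b)"
        using p'[unfolded b] lucas_fib_diff[of j b] j(1) by (simp add: mult.commute mult.left_commute)
      then show ?thesis using assms(2) by simp
    qed
  qed
qed

subsection \<open>Numbers with a large least prime factor\<close>

text \<open>A composite q would have two prime factors counted with multiplicity, each at least p by
  minimality, forcing q \<ge> p^2.\<close>

lemma prime_or_semiprime_if_less_cube:
  fixes p q :: nat
  assumes "prime p" and least: "\<And>r. prime r \<Longrightarrow> r dvd p * q \<Longrightarrow> p \<le> r"
    and "q > 0" "q < p\<^sup>2"
  shows "q = 1 \<or> prime q"
proof (rule disjCI)
  assume "\<not> prime q"
  show "q = 1"
  proof (rule ccontr)
    assume "q \<noteq> 1"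
    then obtain r where r: "prime r" "r dvd q" using prime_factor_nat by blast
    then obtain s where s: "q = r * s" by (elim dvdE)
    have "s \<noteq> 1" using s r(1) \<open>\<not> prime q\<close> by auto
    then obtain t where t: "prime t" "t dvd s" using prime_factor_nat by blast
    have "p \<le> r" "p \<le> t" using r t s least by auto
    moreover have "t \<le> s" using t(2) s assms(3) by (intro dvd_imp_le) auto
    ultimately have "p * p \<le> r * s" by (intro mult_le_mono) auto
    then show False using s assms(4) by (simp add: power2_eq_square)
  qed
qed

section \<open>Values and a lower bound of sigma_2\<close>

lemma sigma2_prime:
  assumes "prime p"
  shows "sigma2 p = 1 + p\<^sup>2"
proof -
  have "{d. d dvd p} = {1, p}" using assms by (auto simp: prime_nat_iff)
  then show ?thesis using assms prime_gt_1_nat[of p] by (simp add: sigma2_def)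
qed

lemma divisors_semiprime:
  fixes p q :: nat
  assumes "prime p" "prime q"
  shows "{d. d dvd p * q} = {1, p, q, p * q}"
proof
  show "{d. d dvd p * q} \<subseteq> {1, p, q, p * q}"
  proof
    fix d assume "d \<in> {d. d dvd p * q}"
    then obtain a b where ab: "d = a * b" "a dvd p" "b dvd q"
      using division_decomp[of d p q] by auto
    then have "a = 1 \<or> a = p" "b = 1 \<or> b = q" using assms by (simp_all add: prime_nat_iff)
    then show "d \<in> {1, p, q, p * q}" using ab(1) by auto
  qed
qed auto

lemma sigma2_prime_square:
  assumes "prime p"
  shows "sigma2 (p * p) = 1 + p\<^sup>2 + (p * p)\<^sup>2"
  using prime_gt_1_nat[OF assms] unfolding sigma2_def divisors_semiprime[OF assms assms] by simp

lemma sigma2_semiprime: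
  assumes "prime p" "prime q" "p \<noteq> q"
  shows "sigma2 (p * q) = 1 + p\<^sup>2 + q\<^sup>2 + (p * q)\<^sup>2"
  using prime_gt_1_nat[OF assms(1)] prime_gt_1_nat[OF assms(2)] assms(3)
  unfolding sigma2_def divisors_semiprime[OF assms(1,2)] by simp

text \<open>As p > 1 and q > 0, the divisors q and pq are distinct. Once n^2 is cancelled in the
  main equation, this bounds the cofactor q.\<close>

lemma sigma2_ge_two_largest:
  fixes p q :: nat
  assumes "p > 1" "q > 0"
  shows "q\<^sup>2 + (p * q)\<^sup>2 \<le> sigma2 (p * q)"
proof -
  have "(\<Sum>d\<in>{q, p * q}. d\<^sup>2) \<le> sigma2 (p * q)"
    unfolding sigma2_def using assms by (intro sum_mono2) auto
  then show ?thesis using assms by simp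
qed

section \<open>Solving the equation for sigma_2\<close>

theorem theorem1p4:
  fixes m n :: nat
  assumes "m > 0" and "n > 0"
    and "int (sigma2 n) - (int n)\<^sup>2 = int (lucas (2*m)) * int n + ((int (lucas (2*m)))\<^sup>2 - 3)"
    and "int n > ((int (lucas (2*m)))\<^sup>2 + int (lucas (2*m)) - 3) ^ 3"
  shows "\<exists>k>0. n = lucas (2*k - 1) * lucas (2*k + 2*m - 1)
           \<and> prime (lucas (2*k - 1)) \<and> prime (lucas (2*k + 2*m - 1))"
proof -
  define A where "A = int (lucas (2 * m))"
  define C where "C = A\<^sup>2 + A - 3"
  have A3: "A \<ge> 3" using lucas_even_ge_3[OF assms(1)] by (simp add: A_def)
  have "3\<^sup>2 \<le> A\<^sup>2" using A3 by (intro power_mono) auto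
  then have A9: "A\<^sup>2 \<ge> 9" by simp
  have eq: "int (sigma2 n) = (int n)\<^sup>2 + A * int n + (A\<^sup>2 - 3)"
    using assms(3) by (simp add: A_def)
  have big: "int n > C ^ 3" using assms(4) by (simp add: A_def C_def)
  have C9: "C \<ge> 9" using A9 A3 by (simp add: C_def)
  have "1 ^ 3 \<le> C ^ 3" using C9 by (intro power_mono) auto
  then have "n \<noteq> 1" using big by simp
  define p where "p = (LEAST p. prime p \<and> p dvd n)"
  have p: "prime p \<and> p dvd n"
    unfolding p_def using prime_factor_nat[OF \<open>n \<noteq> 1\<close>] by (rule LeastI_ex)
  have least: "p \<le> r" if "prime r" "r dvd n" for r
    unfolding p_def using that by (intro Least_le) simp
  obtain q where n: "n = p * q" using p by (elim conjE dvdE)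
  have p1: "p > 1" using p prime_gt_1_nat by blast
  have q0: "q > 0" using n assms(2) by (cases q) auto
  have "int (q\<^sup>2 + n\<^sup>2) \<le> int (sigma2 n)"
    using sigma2_ge_two_largest[OF p1 q0] unfolding n of_nat_le_iff .
  then have "(int q)\<^sup>2 \<le> A * int n + (A\<^sup>2 - 3)" using eq by simp
  \<comment> \<open>Since n \<ge> 1, the constant term can be absorbed into the linear one; this is
    where \<open>C\<close> comes from.\<close>
  also have "\<dots> \<le> A * int n + (A\<^sup>2 - 3) * int n"
    using assms(2) A9 by simp
  also have "\<dots> = C * int n" by (simp add: C_def algebra_simps)
  finally have "int q * int q \<le> (C * int p) * int q" by (simp add: n power2_eq_square algebra_simps)
  then have qC: "int q \<le> C * int p" using q0 by simp
  have "q < p\<^sup>2"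
  proof (rule ccontr)
    \<comment> \<open>Then p^2 \<le> q \<le> Cp gives p \<le> C, hence n = pq \<le> C p^2 \<le>
      C^3.\<close>
    assume "\<not> q < p\<^sup>2"
    then have "int p * int p \<le> int q"
      by (metis not_less of_nat_le_iff of_nat_mult power2_eq_square)
    then have "int p * int p \<le> C * int p" using qC by linarith
    then have pC: "int p \<le> C" using p1 by simp
    have "int n \<le> int p * (C * int p)" using qC by (simp add: n mult_left_mono)
    also have "\<dots> \<le> C * (C * C)" using pC C9 by (intro mult_mono) auto
    finally show False using big by (simp add: power3_eq_cube)
  qed
  then have "q = 1 \<or> prime q"
    using p least n q0 by (intro prime_or_semiprime_if_less_cube[of p]) auto
  moreover have "q \<noteq> 1"
  proof
    assume "q = 1"
    \<comment> \<open>For prime n the left side of the equation is 1, while A^2 - 3 is at least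
      6.\<close>
    then have "A * int n + (A\<^sup>2 - 3) = 1" using eq p by (simp add: n sigma2_prime)
    moreover have "A * int n \<ge> 0" using A3 by simp
    ultimately show False using A9 by linarith
  qed
  ultimately have q: "prime q" by simp
  have "p \<noteq> q"
  proof
    assume "p = q"
    then have "1 + int n = A * int n + (A\<^sup>2 - 3)"
      using eq q by (simp add: n sigma2_prime_square power2_eq_square)
    moreover have "1 * int n \<le> A * int n" using A3 by (intro mult_right_mono) auto
    ultimately show False using A9 by linarith
  qed
  then have "(int p)\<^sup>2 + (int q)\<^sup>2 - A * int p * int q = A\<^sup>2 - 4"
    using eq p q by (simp add: n sigma2_semiprime)
  then obtain j where "odd j"
    and j: "q = lucas j \<and> p = lucas (j + 2 * m) \<or> p = lucas j \<and> q = lucas (j + 2 * m)"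
    using lucas_quadratic_solutions[of m p q] assms(1) p1 by (auto simp: A_def)
  \<comment> \<open>The witness k = i + 1 is positive and satisfies 2k - 1 = j.\<close>
  from \<open>odd j\<close> obtain i where "j = 2 * i + 1" by (elim oddE)
  then have "2 * (i + 1) - 1 = j" "2 * (i + 1) + 2 * m - 1 = j + 2 * m" by auto
  then show ?thesis
    using j p q n by (intro exI[of _ "i + 1"]) (auto simp: mult.commute)
qed

end
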